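(* Let $\mathbf{U},\mathbf{V}\in\mathbb{R}^{MN}$ satisfy the fully discrete approximation described in the context (with homogeneous boundary data), where the discrete time derivative operators $D_t^{(i)},D_t^{(j)}$ ($i,j\in\{1,2\}$) satisfy Assumptions (A.1)-(A.2) in time and (B.1). Suppose the penalty parameters satisfy $\mu_1<-1/2$, $\mu_3<-1/2$, $\mu_2=\mu_1$, $\mu_4=-\mu_1\mu_3$, and suppose that the damping does not vanish: $\sigma(x_i)\neq0$ for all $i=1,\dots,N$. Then there is a non-dimensional constant $C>0$, independent of the space-time grid parameters, such that for all $\Delta t>0$ $$\mathcal{E}_M+\sum_{k=1}^M \operatorname{BT}_{hk}h_k\Delta t\le C\,\mathcal{E}_0+\frac{1}{2\delta}\sum_{k=1}^M h_k\|\mathbf{c}^{-1}\mathbf{S}_k\|_{H_x}^2\Delta t,$$ where $\operatorname{BT}_{hk}=\frac{\beta_R}{\alpha_R}V_{kN}^2-\frac{\beta_L}{\alpha_L}V_{k1}^2\ge 0$, $\delta=2\min_{1\le i\le N}(\sigma(x_i))^2$, and $h_k>0$ are the (non-dimensional) quadrature weights of $H_t$.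
   Context: Space grid: $\Omega=[x_L,x_R]$, uniform points $x_1=x_L,\dots,x_N=x_R$, $\Delta x=(x_R-x_L)/(N-1)$. A triplet $(D_x^-,D_x^+,H_x)$ of $N\times N$ matrices satisfies the DP-SBP framework if: (A.1) $H_x=\operatorname{diag}(h_1\Delta x,\dots,h_N\Delta x)$ is diagonal and positive definite, defines $(\mathbf f,\mathbf g)_{H_x}=\mathbf f^\top H_x\mathbf g$ and $\|\mathbf f\|_{H_x}^2=(\mathbf f,\mathbf f)_{H_x}$, and $(\mathbf 1,\mathbf f)_{H_x}=\sum_i h_if(x_i)\Delta x$ is a quadrature converging to $\int_\Omega f\,dx$ as $N\to\infty$; (A.2) $D_x^\pm$ differentiate grid restrictions of polynomials of degree at most $p$ exactly; (A.3) $(D_x^+\mathbf f,\mathbf g)_{H_x}+(\mathbf f,D_x^-\mathbf g)_{H_x}=f_Ng_N-f_1g_1$ for all $\mathbf f,\mathbf g\in\mathbb R^N$; (A.4) $(\mathbf f,(D_x^+-D_x^-)\mathbf f)_{H_x}\le 0$ for all $\mathbf f$. Time grid: $[0,T]$ with uniform points $t_1=0,\dots,t_M=T$, $\Delta t=T/(M-1)$. $H_t=\operatorname{diag}(h_1\Delta t,\dots,h_M\Delta t)$ is positive definite (the weights $h_k$ in sums over $k$ are those of $H_t$), and $D_t^{(1)},D_t^{(2)}\in\mathbb R^{M\times M}$ are discrete first derivatives in time such that $(H_t,D_t^{(j)})$ satisfies the analogues of (A.1)-(A.2) in time and (B.1): with $Q_t^{(j)}=H_tD_t^{(j)}-\frac12(e_Me_M^\top-e_1e_1^\top)$,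 the matrix $S_t^{(j)}=Q_t^{(j)}+(Q_t^{(j)})^\top$ satisfies $\mathbf f^\top S_t^{(j)}\mathbf f\ge0$ for all $\mathbf f\in\mathbb R^M$. Here $e_1,e_M\in\mathbb{R}^M$ (and $e_1,e_N\in\mathbb R^N$ in space) are the first and last standard basis vectors. Coefficients: $\mathbf c=\operatorname{diag}(c(x_1),\dots,c(x_N))$ with $c(x)\ne0$, $\pmb\sigma=\operatorname{diag}(\sigma(x_1),\dots,\sigma(x_N))$ (real). Real boundary parameters satisfy $\alpha_L\ne0$, $\alpha_R\ne0$, $\alpha_L\beta_L\le0$, $\alpha_R\beta_R\ge0$. Put $\widetilde D_{xx}=-H_x^{-1}(D_x^-)^\top H_xD_x^-$ and $B=H_x^{-1}\mathbf c^2\left(\frac{\beta_R}{\alpha_R}e_Ne_N^\top-\frac{\beta_L}{\alpha_L}e_1e_1^\top\right)$. Unknown: $\mathbf U=[\mathbf U_1^\top\cdots\mathbf U_M^\top]^\top\in\mathbb R^{MN}$, $\mathbf U_k=[U_{k1},\dots,U_{kN}]^\top$ (similarly for $\mathbf V$). Initial data $\mathbf f,\mathbf g\in\mathbb R^N$, $\mathbf F=(e_1\otimes I_x)\mathbf f$, $\mathbf G=(e_1\otimes I_x)\mathbf g$. $\bar{\mathbf S}\in\mathbb R^{MN}$ has blocks $\mathbf S_k=\mathbf S(t_k)$, the source sampled on the grid (homogeneous boundary data give no further contribution). The fully discrete approximation is $$(D_t^{(i)}D_t^{(j)}\otimes I_x)\mathbf U+(D_t^{(j)}\otimes(\pmb\sigma^2+B))\mathbf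 U-(I_t\otimes\mathbf c^2\widetilde D_{xx})\mathbf U=\operatorname{SAT}+\bar{\mathbf S},$$ $$\operatorname{SAT}=\mu_1(H_t^{-1}e_1e_1^\top\otimes(\pmb\sigma^2+B))(\mathbf U-\mathbf F)+\mu_2(D_t^{(i)}H_t^{-1}e_1e_1^\top\otimes I_x)(\mathbf U-\mathbf F)+\mu_3(H_t^{-1}e_1e_1^\top\otimes I_x)\left((D_t^{(j)}\otimes I_x)\mathbf U-\mathbf G\right)+\mu_4(H_t^{-1}e_1e_1^\top H_t^{-1}e_1e_1^\top\otimes I_x)(\mathbf U-\mathbf F),$$ or equivalently (when $\mu_2=\mu_1$, $\mu_4=-\mu_1\mu_3$), with an auxiliary field $\mathbf V$, $$\mathbf V=(D_t^{(j)}\otimes I_x)\mathbf U-\mu_1(H_t^{-1}e_1e_1^\top\otimes I_x)(\mathbf U-\mathbf F),$$ $$(D_t^{(i)}\otimes I_x)\mathbf V+(I_t\otimes(\pmb\sigma^2+B))\mathbf V=(I_t\otimes\mathbf c^2\widetilde D_{xx})\mathbf U+\mu_3(H_t^{-1}e_1e_1^\top\otimes I_x)(\mathbf V-\mathbf G)+\bar{\mathbf S}.$$ Discrete energy: $\mathcal E_k=\frac12\left(\|\mathbf c^{-1}\mathbf V_k\|_{H_x}^2+\|D_x^-\mathbf U_k\|_{H_x}^2\right)$ for $k=1,\dots,M$, and $\mathcal E_0=\frac12\left(\|\mathbf c^{-1}\mathbf g\|_{H_x}^2+\|D_x^-\mathbf f\|_{H_x}^2\right)$. *)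

theory Defs
  imports
    "HOL-Analysis.Henstock_Kurzweil_Integration"
    "HOL-Computational_Algebra.Polynomial"
    "Jordan_Normal_Form.Gauss_Jordan_Elimination"
begin

text \<open>Vectors and matrices are those of Jordan_Normal_Form, so that the numbers of grid points
  are ordinary natural numbers. Indices start at 0: the grid points
  \<open>x\<^sub>1, \<dots>, x\<^sub>N\<close> are \<open>grid_pt a b N 0, \<dots>, grid_pt a b N (N - 1)\<close>.\<close>

unbundle no inner_syntax

text \<open>For a singular matrix this is an unspecified value.\<close>

definition inv_mat :: "real mat \<Rightarrow> real mat" where
  "inv_mat A = the (mat_inverse A)"

definition pos_def :: "nat \<Rightarrow> real mat \<Rightarrow> bool" where
  "pos_def n A \<longleftrightarrow> A \<in> carrier_mat n n \<and> transpose_mat A = A \<and>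
     (\<forall>v \<in> carrier_vec n. v \<noteq> 0\<^sub>v n \<longrightarrow> v \<bullet> (A *\<^sub>v v) > 0)"

definition kron :: "real mat \<Rightarrow> real mat \<Rightarrow> real mat" (infixr \<open>\<otimes>\<^sub>K\<close> 75) where
  "A \<otimes>\<^sub>K B = mat (dim_row A * dim_row B) (dim_col A * dim_col B)
     (\<lambda>(r, s). A $$ (r div dim_row B, s div dim_col B) * B $$ (r mod dim_row B, s mod dim_col B))"

definition unit_col :: "nat \<Rightarrow> nat \<Rightarrow> real mat" where
  "unit_col n k = mat_of_cols n [unit_vec n k]"

definition unit_proj :: "nat \<Rightarrow> nat \<Rightarrow> real mat" where
  "unit_proj n k = unit_col n k * transpose_mat (unit_col n k)"

text \<open>The block \<open>U\<^sub>k \<in> \<real>\<^sup>N\<close> of \<open>U = [U\<^sub>1\<^sup>T \<dots> U\<^sub>M\<^sup>T]\<^sup>T\<close>, with \<open>k\<close> counted from 0.\<close>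

definition block :: "nat \<Rightarrow> real vec \<Rightarrow> nat \<Rightarrow> real vec" where
  "block N U k = vec N (\<lambda>i. U $ (k * N + i))"

definition inner_prod :: "real mat \<Rightarrow> real vec \<Rightarrow> real vec \<Rightarrow> real" where
  "inner_prod H f g = f \<bullet> (H *\<^sub>v g)"

definition norm_sq :: "real mat \<Rightarrow> real vec \<Rightarrow> real" where
  "norm_sq H f = inner_prod H f f"

definition grid_step :: "real \<Rightarrow> real \<Rightarrow> nat \<Rightarrow> real" where
  "grid_step a b n = (b - a) / (real n - 1)"

definition grid_pt :: "real \<Rightarrow> real \<Rightarrow> nat \<Rightarrow> nat \<Rightarrow> real" where
  "grid_pt a b n i = a + real i * grid_step a b n"

definition grid_fun :: "real \<Rightarrow> real \<Rightarrow> nat \<Rightarrow> (real \<Rightarrow> real) \<Rightarrow> real vec" where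
  "grid_fun a b n u = vec n (\<lambda>i. u (grid_pt a b n i))"

definition grid_diag :: "real \<Rightarrow> real \<Rightarrow> nat \<Rightarrow> (real \<Rightarrow> real) \<Rightarrow> real mat" where
  "grid_diag a b n u = mat_diag n (\<lambda>i. u (grid_pt a b n i))"

definition norm_mat :: "real \<Rightarrow> real \<Rightarrow> nat \<Rightarrow> (nat \<Rightarrow> real) \<Rightarrow> real mat" where
  "norm_mat a b n h = mat_diag n (\<lambda>i. h i * grid_step a b n)"

text \<open>Convergence of the quadrature concerns the limit of infinitely many grid points.
  Weights and operators are therefore families indexed by the number of grid points \<open>n\<close>
  (\<open>h n i\<close> is the weight of node \<open>i\<close> on the grid with \<open>n\<close> points), and the properties are
  required from some minimal number of points \<open>n0\<close> on, because a stencil of given order needs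
  a certain number of points.\<close>

definition quadrature_norm :: "real \<Rightarrow> real \<Rightarrow> nat \<Rightarrow> (nat \<Rightarrow> nat \<Rightarrow> real) \<Rightarrow> bool" where
  "quadrature_norm a b n0 h \<longleftrightarrow>
     (\<forall>n\<ge>n0. pos_def n (norm_mat a b n (h n))) \<and>
     (\<forall>u. continuous_on {a..b} u \<longrightarrow>
        (\<lambda>n. inner_prod (norm_mat a b n (h n)) (vec n (\<lambda>_. 1)) (grid_fun a b n u))
          \<longlonglongrightarrow> integral {a..b} u)"

definition exact_deriv :: "real \<Rightarrow> real \<Rightarrow> nat \<Rightarrow> nat \<Rightarrow> real mat \<Rightarrow> bool" where
  "exact_deriv a b n p D \<longleftrightarrow> D \<in> carrier_mat n n \<and>
     (\<forall>q :: real poly. degree q \<le> p \<longrightarrow>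
        D *\<^sub>v grid_fun a b n (poly q) = grid_fun a b n (poly (pderiv q)))"

definition dp_sbp :: "real \<Rightarrow> real \<Rightarrow> nat \<Rightarrow> nat \<Rightarrow> (nat \<Rightarrow> nat \<Rightarrow> real) \<Rightarrow>
    (nat \<Rightarrow> real mat) \<Rightarrow> (nat \<Rightarrow> real mat) \<Rightarrow> bool" where
  "dp_sbp a b p n0 h Dm Dp \<longleftrightarrow> n0 \<ge> 2 \<and> quadrature_norm a b n0 h \<and>
     (\<forall>n\<ge>n0. let H = norm_mat a b n (h n) in
        exact_deriv a b n p (Dm n) \<and> exact_deriv a b n p (Dp n) \<and>
        (\<forall>f \<in> carrier_vec n. \<forall>g \<in> carrier_vec n.
           inner_prod H (Dp n *\<^sub>v f) g + inner_prod H f (Dm n *\<^sub>v g)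
             = f $ (n - 1) * g $ (n - 1) - f $ 0 * g $ 0) \<and>
        (\<forall>f \<in> carrier_vec n. inner_prod H f ((Dp n - Dm n) *\<^sub>v f) \<le> 0))"

definition time_sbp :: "real \<Rightarrow> nat \<Rightarrow> nat \<Rightarrow> (nat \<Rightarrow> nat \<Rightarrow> real) \<Rightarrow>
    (nat \<Rightarrow> real mat) \<Rightarrow> bool" where
  "time_sbp T p m0 h D \<longleftrightarrow> m0 \<ge> 2 \<and> quadrature_norm 0 T m0 h \<and>
     (\<forall>m\<ge>m0. exact_deriv 0 T m p (D m) \<and>
        (let Q = norm_mat 0 T m (h m) * D m - (1/2) \<cdot>\<^sub>m (unit_proj m (m - 1) - unit_proj m 0);
             S = Q + transpose_mat Q
         in \<forall>f \<in> carrier_vec m. f \<bullet> (S *\<^sub>v f) \<ge> 0))"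

definition Dxx_tilde :: "real mat \<Rightarrow> real mat \<Rightarrow> real mat" where
  "Dxx_tilde Hx Dm = - (inv_mat Hx * transpose_mat Dm * Hx * Dm)"

definition boundary_mat :: "nat \<Rightarrow> real mat \<Rightarrow> real mat \<Rightarrow> real \<Rightarrow> real \<Rightarrow> real \<Rightarrow> real \<Rightarrow> real mat" where
  "boundary_mat N Hx cm \<alpha>L \<beta>L \<alpha>R \<beta>R = inv_mat Hx * cm ^\<^sub>m 2 *
     ((\<beta>R / \<alpha>R) \<cdot>\<^sub>m unit_proj N (N - 1) - (\<beta>L / \<alpha>L) \<cdot>\<^sub>m unit_proj N 0)"

definition initial_ext :: "nat \<Rightarrow> nat \<Rightarrow> real vec \<Rightarrow> real vec" where
  "initial_ext M N f = (unit_col M 0 \<otimes>\<^sub>K 1\<^sub>m N) *\<^sub>v f"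

definition source_vec :: "real \<Rightarrow> real \<Rightarrow> real \<Rightarrow> nat \<Rightarrow> nat \<Rightarrow> (real \<Rightarrow> real \<Rightarrow> real) \<Rightarrow> nat \<Rightarrow> real vec" where
  "source_vec xL xR T N M src k = grid_fun xL xR N (\<lambda>x. src x (grid_pt 0 T M k))"

definition source_ext :: "real \<Rightarrow> real \<Rightarrow> real \<Rightarrow> nat \<Rightarrow> nat \<Rightarrow> (real \<Rightarrow> real \<Rightarrow> real) \<Rightarrow> real vec" where
  "source_ext xL xR T N M src =
     vec (M * N) (\<lambda>r. source_vec xL xR T N M src (r div N) $ (r mod N))"

text \<open>\<open>A\<close> stands for \<open>\<sigma>\<^sup>2 + B\<close>.\<close>

definition SAT :: "nat \<Rightarrow> nat \<Rightarrow> real \<Rightarrow> real \<Rightarrow> real \<Rightarrow> real \<Rightarrow> real mat \<Rightarrow> real mat \<Rightarrow> real mat \<Rightarrow>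
    real mat \<Rightarrow> real vec \<Rightarrow> real vec \<Rightarrow> real vec \<Rightarrow> real vec" where
  "SAT N M \<mu>1 \<mu>2 \<mu>3 \<mu>4 Ht Di Dj A f g U =
    (let E = inv_mat Ht * unit_proj M 0; I = 1\<^sub>m N;
         F = initial_ext M N f; G = initial_ext M N g
     in \<mu>1 \<cdot>\<^sub>v ((E \<otimes>\<^sub>K A) *\<^sub>v (U - F))
        + \<mu>2 \<cdot>\<^sub>v (((Di * E) \<otimes>\<^sub>K I) *\<^sub>v (U - F))
        + \<mu>3 \<cdot>\<^sub>v ((E \<otimes>\<^sub>K I) *\<^sub>v ((Dj \<otimes>\<^sub>K I) *\<^sub>v U - G))
        + \<mu>4 \<cdot>\<^sub>v (((E * E) \<otimes>\<^sub>K I) *\<^sub>v (U - F)))"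

definition fully_discrete :: "nat \<Rightarrow> nat \<Rightarrow> real \<Rightarrow> real \<Rightarrow> real \<Rightarrow> real \<Rightarrow> real mat \<Rightarrow> real mat \<Rightarrow> real mat \<Rightarrow>
    real mat \<Rightarrow> real mat \<Rightarrow> real mat \<Rightarrow> real mat \<Rightarrow> real \<Rightarrow> real \<Rightarrow> real \<Rightarrow> real \<Rightarrow>
    real vec \<Rightarrow> real vec \<Rightarrow> real vec \<Rightarrow> real vec \<Rightarrow> bool" where
  "fully_discrete N M \<mu>1 \<mu>2 \<mu>3 \<mu>4 Ht Di Dj Hx Dm cm \<sigma>m \<alpha>L \<beta>L \<alpha>R \<beta>R f g Sbar U \<longleftrightarrow>
    (let A = \<sigma>m ^\<^sub>m 2 + boundary_mat N Hx cm \<alpha>L \<beta>L \<alpha>R \<beta>R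
     in U \<in> carrier_vec (M * N) \<and>
        ((Di * Dj) \<otimes>\<^sub>K 1\<^sub>m N) *\<^sub>v U + (Dj \<otimes>\<^sub>K A) *\<^sub>v U
          - (1\<^sub>m M \<otimes>\<^sub>K (cm ^\<^sub>m 2 * Dxx_tilde Hx Dm)) *\<^sub>v U
        = SAT N M \<mu>1 \<mu>2 \<mu>3 \<mu>4 Ht Di Dj A f g U + Sbar)"

text \<open>If \<open>\<mu>2 = \<mu>1\<close> and \<open>\<mu>4 = - \<mu>1 * \<mu>3\<close>, inserting this field \<open>V\<close> turns the second-order
  scheme into \<open>(Di \<otimes> I) V + (I \<otimes> A) V = (I \<otimes> c\<^sup>2 Dxx) U + \<mu>3 (E \<otimes> I) (V - G) + S\<close>,
  where \<open>E = Ht\<inverse> e\<^sub>1 e\<^sub>1\<^sup>T\<close>.\<close>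

definition aux_field :: "nat \<Rightarrow> nat \<Rightarrow> real \<Rightarrow> real mat \<Rightarrow> real mat \<Rightarrow> real vec \<Rightarrow> real vec \<Rightarrow> real vec" where
  "aux_field N M \<mu>1 Ht Dj f U = (Dj \<otimes>\<^sub>K 1\<^sub>m N) *\<^sub>v U
     - \<mu>1 \<cdot>\<^sub>v (((inv_mat Ht * unit_proj M 0) \<otimes>\<^sub>K 1\<^sub>m N) *\<^sub>v (U - initial_ext M N f))"

definition energy :: "real mat \<Rightarrow> real mat \<Rightarrow> real mat \<Rightarrow> real vec \<Rightarrow> real vec \<Rightarrow> real" where
  "energy Hx Dm cm u v = 1/2 * (norm_sq Hx (inv_mat cm *\<^sub>v v) + norm_sq Hx (Dm *\<^sub>v u))"

definition boundary_term :: "nat \<Rightarrow> real \<Rightarrow> real \<Rightarrow> real \<Rightarrow> real \<Rightarrow> real vec \<Rightarrow> real" where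
  "boundary_term N \<alpha>L \<beta>L \<alpha>R \<beta>R v = \<beta>R / \<alpha>R * (v $ (N - 1))\<^sup>2 - \<beta>L / \<alpha>L * (v $ 0)\<^sup>2"

end

theory Submission
  imports Defs
begin

text \<open>Eliminating the auxiliary field \<open>V\<close> turns the scheme into a first order system in time for
  \<open>(U, V)\<close>, in which the penalties act only at \<open>t = 0\<close>. Pair the second equation with \<open>V\<close> in the
  space-time inner product weighted by \<open>c\<^sup>-\<^sup>2\<close>, and \<open>D\<^sub>x\<^sup>-\<close> of the first with \<open>D\<^sub>x\<^sup>- U\<close>. The spatial terms
  cancel, because \<open>(V, Dxx U)\<^sub>H = - (D\<^sub>x\<^sup>- V, D\<^sub>x\<^sup>- U)\<^sub>H\<close>. In time, (B.1) together with a penalty of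
  strength \<open>\<mu> < -1/2\<close> bounds the energy at \<open>T\<close> up to \<open>\<mu>\<^sup>2 / (-1 - 2\<mu>)\<close> times the initial energy.
  Young's inequality absorbs the source into the damping \<open>\<sigma>\<^sup>2\<close>.\<close>

section \<open>Diagonal matrices and their inverses\<close>

lemma dim_mat_diag [simp]: "dim_row (mat_diag n d) = n" "dim_col (mat_diag n d) = n"
  by (auto simp: mat_diag_def)

lemma dim_kron [simp]:
  "dim_row (A \<otimes>\<^sub>K B) = dim_row A * dim_row B" "dim_col (A \<otimes>\<^sub>K B) = dim_col A * dim_col B"
  by (auto simp: kron_def)

lemma mat_diag_index [simp]:
  "i < n \<Longrightarrow> j < n \<Longrightarrow> mat_diag n d $$ (i, j) = (if i = j then d i else 0)"
  by (auto simp: mat_diag_def)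

lemma mat_diag_eqI: "(\<And>i. i < n \<Longrightarrow> d i = e i) \<Longrightarrow> mat_diag n d = mat_diag n e"
  by (intro eq_matI) auto

lemma mat_diag_add: "mat_diag n d + mat_diag n e = (mat_diag n (\<lambda>i. d i + e i) :: real mat)"
  by (intro eq_matI) auto

lemma mat_diag_minus: "mat_diag n d - mat_diag n e = (mat_diag n (\<lambda>i. d i - e i) :: real mat)"
  by (intro eq_matI) auto

lemma mat_diag_smult: "r \<cdot>\<^sub>m mat_diag n d = (mat_diag n (\<lambda>i. r * d i) :: real mat)"
  by (intro eq_matI) auto

lemma mat_diag_square: "mat_diag n d ^\<^sub>m 2 = (mat_diag n (\<lambda>i. (d i)\<^sup>2) :: real mat)"
  by (simp add: numeral_2_eq_2 power2_eq_square mat_diag_dim)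

lemma mult_mat_vec_index:
  fixes A :: "real mat"
  assumes "A \<in> carrier_mat m n" "v \<in> carrier_vec n" "i < m"
  shows "(A *\<^sub>v v) $ i = (\<Sum>j<n. A $$ (i, j) * v $ j)"
  using assms by (auto simp: scalar_prod_def atLeast0LessThan intro!: sum.cong)

lemma mat_diag_mult_vec:
  assumes "v \<in> carrier_vec n"
  shows "mat_diag n d *\<^sub>v v = vec n (\<lambda>i. d i * v $ i :: real)"
proof (rule eq_vecI)
  fix i assume "i < dim_vec (vec n (\<lambda>i. d i * v $ i))"
  then have i: "i < n" by simp
  have "(mat_diag n d *\<^sub>v v) $ i = (\<Sum>j<n. if j = i then d j * v $ j else 0)"
    unfolding mult_mat_vec_index[OF mat_diag_dim assms i] using i by (intro sum.cong refl) auto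
  then show "(mat_diag n d *\<^sub>v v) $ i = vec n (\<lambda>i. d i * v $ i) $ i"
    using i by simp
qed simp

text \<open>The diagonal of reciprocals is a two-sided inverse, so the matrix is a unit of the
  matrix ring and \<open>mat_inverse\<close> does not return \<open>None\<close>. Uniqueness of
  inverses then identifies the value of \<open>inv_mat\<close>.\<close>

lemma inv_mat_diag:
  assumes "\<And>i. i < n \<Longrightarrow> d i \<noteq> 0"
  shows "inv_mat (mat_diag n d) = mat_diag n (\<lambda>i. inverse (d i))"
proof -
  let ?A = "mat_diag n d" and ?B = "mat_diag n (\<lambda>i. inverse (d i))"
  have AB: "?A * ?B = 1\<^sub>m n" "?B * ?A = 1\<^sub>m n"
    using assms by (auto simp: mat_diag_diag intro!: eq_matI)
  have "\<exists>B\<in>carrier_mat n n. B * ?A = 1\<^sub>m n \<and> ?A * B = 1\<^sub>m n"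
    using AB mat_diag_dim by blast
  then have "?A \<in> Units (ring_mat TYPE(real) n ())"
    by (simp add: Units_def ring_mat_def)
  then have "mat_inverse ?A \<noteq> None"
    using mat_inverse(1)[OF mat_diag_dim[of n d], where b = "()"] by argo
  then obtain B where B: "mat_inverse ?A = Some B" by blast
  have inv: "?A * B = 1\<^sub>m n" "B * ?A = 1\<^sub>m n" "B \<in> carrier_mat n n"
    using mat_inverse(2)[OF mat_diag_dim B] by blast+
  have "B = B * (?A * ?B)" unfolding AB using inv(3) by (rule right_mult_one_mat[symmetric])
  also have "\<dots> = B * ?A * ?B"
    using inv(3) mat_diag_dim mat_diag_dim by (rule assoc_mult_mat[symmetric])
  also have "\<dots> = ?B" unfolding inv(2) by (rule left_mult_one_mat[OF mat_diag_dim])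
  finally show ?thesis by (simp add: inv_mat_def B)
qed

lemma unit_proj_diag:
  assumes "k < n"
  shows "unit_proj n k = mat_diag n (\<lambda>i. if i = k then 1 else 0)"
  using assms by (intro eq_matI)
    (auto simp: unit_proj_def unit_col_def mat_of_cols_def scalar_prod_def)

lemma inner_prod_diag:
  assumes "f \<in> carrier_vec n" "g \<in> carrier_vec n"
  shows "inner_prod (mat_diag n d) f g = (\<Sum>i<n. d i * f $ i * g $ i)"
  using assms by (auto simp: inner_prod_def mat_diag_mult_vec scalar_prod_def atLeast0LessThan
      intro!: sum.cong)

text \<open>Testing the quadratic form on a standard basis vector isolates one diagonal entry. This
  yields the positivity of quadrature weights times grid step.\<close>

lemma pos_def_diag:
  assumes "pos_def n (mat_diag n d)" "i < n"
  shows "d i > 0"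
proof -
  have "unit_vec n i $ i \<noteq> (0\<^sub>v n :: real vec) $ i" using assms(2) by simp
  then have ne: "unit_vec n i \<noteq> (0\<^sub>v n :: real vec)" by metis
  have "0 < inner_prod (mat_diag n d) (unit_vec n i) (unit_vec n i)"
    using assms(1) ne by (auto simp: pos_def_def inner_prod_def)
  also have "\<dots> = d i"
    using assms(2) by (simp add: inner_prod_diag unit_vec_def if_distrib sum.delta cong: if_cong)
  finally show ?thesis .
qed

section \<open>Kronecker products acting on block vectors\<close>

lemma block_index_less:
  fixes a b m n :: nat
  assumes "a < m" "b < n"
  shows "a * n + b < m * n"
proof -
  have "a * n + b < Suc a * n" using assms by simp
  also have "\<dots> \<le> m * n" using assms by (intro mult_le_mono1) simp
  finally show ?thesis .
qed

text \<open>\<open>div\<close> and \<open>mod\<close> take the row index apart into block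
  \<open>k\<close> and position \<open>i\<close>; cutting the column sum into runs of length
  \<open>n2\<close> does the same for the columns.\<close>

lemma kron_mult_vec_index:
  assumes A: "A \<in> carrier_mat m1 m2" and B: "B \<in> carrier_mat n1 n2"
    and X: "X \<in> carrier_vec (m2 * n2)" and k: "k < m1" and i: "i < n1"
  shows "((A \<otimes>\<^sub>K B) *\<^sub>v X) $ (k * n1 + i)
    = (\<Sum>l<m2. \<Sum>j<n2. A $$ (k, l) * B $$ (i, j) * X $ (l * n2 + j))"
proof -
  have carr: "A \<otimes>\<^sub>K B \<in> carrier_mat (m1 * n1) (m2 * n2)"
    using A B by (simp add: kron_def)
  have "((A \<otimes>\<^sub>K B) *\<^sub>v X) $ (k * n1 + i)
      = (\<Sum>s<m2 * n2. (A \<otimes>\<^sub>K B) $$ (k * n1 + i, s) * X $ s)"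
    by (rule mult_mat_vec_index[OF carr X block_index_less[OF k i]])
  also have "\<dots> = (\<Sum>l<m2. \<Sum>s\<in>{l * n2..<l * n2 + n2}. (A \<otimes>\<^sub>K B) $$ (k * n1 + i, s) * X $ s)"
    by (simp add: sum.nat_group)
  also have "\<dots> = (\<Sum>l<m2. \<Sum>j<n2. (A \<otimes>\<^sub>K B) $$ (k * n1 + i, l * n2 + j) * X $ (l * n2 + j))"
    by (rule sum.cong[OF refl], subst sum.atLeastLessThan_shift_0) (simp add: atLeast0LessThan)
  also have "\<dots> = (\<Sum>l<m2. \<Sum>j<n2. A $$ (k, l) * B $$ (i, j) * X $ (l * n2 + j))"
    using A B k i by (intro sum.cong refl) (simp add: kron_def block_index_less)
  finally show ?thesis .
qed

text \<open>A diagonal factor collapses one of the two sums. Every Kronecker product in the scheme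
  has such a factor, so this rule and its variants below cover all of its terms.\<close>

lemma kron_diag_right:
  assumes A: "A \<in> carrier_mat m1 m2" 
    and X: "X \<in> carrier_vec (m2 * n)" and k: "k < m1" and i: "i < n"
  shows "((A \<otimes>\<^sub>K mat_diag n d) *\<^sub>v X) $ (k * n + i) = d i * (\<Sum>l<m2. A $$ (k, l) * X $ (l * n + i))"
proof -
  have "((A \<otimes>\<^sub>K mat_diag n d) *\<^sub>v X) $ (k * n + i)
    = (\<Sum>l<m2. \<Sum>j<n. if j = i then d i * (A $$ (k, l) * X $ (l * n + j)) else 0)"
    unfolding kron_mult_vec_index[OF A mat_diag_dim X k i]
    using i by (intro sum.cong refl) auto
  then show ?thesis using i by (simp add: sum_distrib_left)
qed

lemma kron_one_right:
  assumes "A \<in> carrier_mat m1 m2" "X \<in> carrier_vec (m2 * n)" "k < m1" "i < n"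
  shows "((A \<otimes>\<^sub>K 1\<^sub>m n) *\<^sub>v X) $ (k * n + i) = (\<Sum>l<m2. A $$ (k, l) * X $ (l * n + i))"
  using kron_diag_right[OF assms, of "\<lambda>_. 1"] by simp

lemma kron_diag_left:
  assumes B: "B \<in> carrier_mat n1 n2" 
    and X: "X \<in> carrier_vec (m * n2)" and k: "k < m" and i: "i < n1"
  shows "((mat_diag m d \<otimes>\<^sub>K B) *\<^sub>v X) $ (k * n1 + i) = d k * (\<Sum>j<n2. B $$ (i, j) * X $ (k * n2 + j))"
proof -
  have "((mat_diag m d \<otimes>\<^sub>K B) *\<^sub>v X) $ (k * n1 + i)
    = (\<Sum>l<m. if l = k then \<Sum>j<n2. d k * (B $$ (i, j) * X $ (k * n2 + j)) else 0)"
    unfolding kron_mult_vec_index[OF mat_diag_dim B X k i]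
    using k by (intro sum.cong refl) (auto simp: mult.assoc)
  then show ?thesis using k by (simp add: sum_distrib_left)
qed

lemma kron_diag_diag:
  assumes X: "X \<in> carrier_vec (m * n)" and k: "k < m" and i: "i < n"
  shows "((mat_diag m d \<otimes>\<^sub>K mat_diag n e) *\<^sub>v X) $ (k * n + i) = d k * e i * X $ (k * n + i)"
proof -
  have "(\<Sum>j<n. mat_diag n e $$ (i, j) * X $ (k * n + j)) = (\<Sum>j<n. if j = i then e j * X $ (k * n + j) else 0)"
    using i by (intro sum.cong refl) auto
  then show ?thesis using kron_diag_left[OF mat_diag_dim X k i, of d e] i by simp
qed

section \<open>Summation by parts and the initial penalty in time\<close>

text \<open>A matrix and its transpose have the same quadratic form, so (B.1) makes the form of
  \<open>Q\<close> nonnegative. \<open>Q\<close> is the weighted derivative minus a diagonal matrix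
  with 1/2 at the last and -1/2 at the first node, which gives the discrete analogue of integrating
  \<open>x' * x\<close>.\<close>

lemma time_sbp_scalar:
  assumes D: "D \<in> carrier_mat m m" and m: "m \<ge> 2"
    and S: "let Q = mat_diag m w * D - (1/2) \<cdot>\<^sub>m (unit_proj m (m - 1) - unit_proj m 0);
             S = Q + transpose_mat Q
         in \<forall>f \<in> carrier_vec m. f \<bullet> (S *\<^sub>v f) \<ge> 0"
  shows "(\<Sum>k<m. w k * (\<Sum>l<m. D $$ (k, l) * x l) * x k) \<ge> 1/2 * ((x (m - 1))\<^sup>2 - (x 0)\<^sup>2)"
proof -
  define f where "f = vec m x"
  define P where "P = (1/2) \<cdot>\<^sub>m (unit_proj m (m - 1) - unit_proj m 0)"
  define Q where "Q = mat_diag m w * D - P"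
  have P: "P = mat_diag m (\<lambda>i. 1/2 * ((if i = m - 1 then 1 else 0) - (if i = 0 then 1 else 0)))"
    unfolding P_def using m by (simp add: unit_proj_diag mat_diag_minus mat_diag_smult)
  have f: "f \<in> carrier_vec m" by (simp add: f_def)
  have Pc: "P \<in> carrier_mat m m" unfolding P by (rule mat_diag_dim)
  have WD: "mat_diag m w * D \<in> carrier_mat m m" using D mat_diag_dim by (rule mult_carrier_mat[rotated])
  have Q: "Q \<in> carrier_mat m m" unfolding Q_def using Pc by (rule minus_carrier_mat)
  have "0 \<le> f \<bullet> ((Q + transpose_mat Q) *\<^sub>v f)"
    using S f by (simp add: Let_def Q_def P_def)
  also have "\<dots> = f \<bullet> (Q *\<^sub>v f) + f \<bullet> (transpose_mat Q *\<^sub>v f)"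
    using Q f by (simp add: add_mult_distrib_mat_vec[of _ m m] scalar_prod_add_distrib[of _ m])
  also have "f \<bullet> (transpose_mat Q *\<^sub>v f) = f \<bullet> (Q *\<^sub>v f)"
    using transpose_vec_mult_scalar[OF Q f f] Q f
    by (metis comm_scalar_prod mult_mat_vec_carrier transpose_carrier_mat)
  finally have "0 \<le> f \<bullet> (Q *\<^sub>v f)" by simp
  also have "\<dots> = f \<bullet> ((mat_diag m w * D) *\<^sub>v f) - f \<bullet> (P *\<^sub>v f)"
    unfolding Q_def using WD Pc f
    by (simp add: minus_mult_distrib_mat_vec[of _ m m] scalar_prod_minus_distrib[of _ m])
  also have "f \<bullet> (P *\<^sub>v f) = 1/2 * ((x (m - 1))\<^sup>2 - (x 0)\<^sup>2)"
  proof -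
    have "f \<bullet> (P *\<^sub>v f) = (\<Sum>i<m. (if i = m - 1 then 1/2 * (x i)\<^sup>2 else 0) - (if i = 0 then 1/2 * (x i)\<^sup>2 else 0))"
      unfolding P mat_diag_mult_vec[OF f] using m
      by (auto simp: f_def scalar_prod_def atLeast0LessThan power2_eq_square intro!: sum.cong)
    then show ?thesis using m by (simp add: sum_subtractf)
  qed
  also have "f \<bullet> ((mat_diag m w * D) *\<^sub>v f) = (\<Sum>k<m. w k * (\<Sum>l<m. D $$ (k, l) * x l) * x k)"
  proof -
    have "(mat_diag m w * D) *\<^sub>v f = mat_diag m w *\<^sub>v (D *\<^sub>v f)"
      using D f by (intro assoc_mult_mat_vec) auto
    moreover have "D *\<^sub>v f = vec m (\<lambda>k. \<Sum>l<m. D $$ (k, l) * x l)"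
      using D f mult_mat_vec_index[OF D f] by (intro eq_vecI) (auto simp: f_def)
    ultimately show ?thesis
      by (simp add: mat_diag_mult_vec scalar_prod_def atLeast0LessThan f_def mult_ac)
  qed
  finally show ?thesis by simp
qed

text \<open>With \<open>r = - 1 - 2 * \<mu>\<close>, summation by parts and the penalty leave
  \<open>r / 2 * (x 0)\<^sup>2 + \<mu> * x0 * x 0\<close> at the initial time. The condition on
  \<mu> makes \<open>r\<close> positive, and completing the square bounds this below by
  \<open>- \<mu>\<^sup>2 / (2 * r) * x0\<^sup>2\<close>; hence the condition on
  \<open>C\<close>.\<close>

lemma time_sat_bound:
  fixes x :: "nat \<Rightarrow> real"
  assumes D: "\<And>x. (\<Sum>k<m. w k * (\<Sum>l<m. D k l * x l) * x k) \<ge> 1/2 * ((x (m - 1))\<^sup>2 - (x 0)\<^sup>2)"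
    and m: "m > 0" and w: "w 0 \<noteq> 0" and \<mu>: "\<mu> < - 1/2" and C: "C \<ge> \<mu>\<^sup>2 / (- 1 - 2 * \<mu>)"
  shows "(\<Sum>k<m. w k * ((\<Sum>l<m. D k l * x l) - (if k = 0 then \<mu> / w 0 * (x 0 - x0) else 0)) * x k)
    \<ge> 1/2 * (x (m - 1))\<^sup>2 - C / 2 * x0\<^sup>2"
proof -
  \<comment> \<open>The division by \<open>w 0\<close> cancels the quadrature weight, so the
    contribution of the penalty does not depend on the time step.\<close>
  have "(\<Sum>k<m. w k * ((\<Sum>l<m. D k l * x l) - (if k = 0 then \<mu> / w 0 * (x 0 - x0) else 0)) * x k)
    = (\<Sum>k<m. w k * (\<Sum>l<m. D k l * x l) * x k - (if k = 0 then \<mu> * (x 0 - x0) * x 0 else 0))"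
    using w by (intro sum.cong refl) (auto simp: field_simps)
  also have "\<dots> = (\<Sum>k<m. w k * (\<Sum>l<m. D k l * x l) * x k) - \<mu> * (x 0 - x0) * x 0"
    using m by (simp add: sum_subtractf)
  also have "\<dots> \<ge> 1/2 * ((x (m - 1))\<^sup>2 - (x 0)\<^sup>2) - \<mu> * (x 0 - x0) * x 0"
    using D[of x] by simp
  finally have 1: "(\<Sum>k<m. w k * ((\<Sum>l<m. D k l * x l) - (if k = 0 then \<mu> / w 0 * (x 0 - x0) else 0)) * x k)
    \<ge> 1/2 * ((x (m - 1))\<^sup>2 - (x 0)\<^sup>2) - \<mu> * (x 0 - x0) * x 0" .
  define r where "r = - 1 - 2 * \<mu>"
  have r: "r > 0" "\<mu> = - (1 + r) / 2" using \<mu> by (auto simp: r_def)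
  have "0 \<le> (r * x 0 + \<mu> * x0)\<^sup>2 / (2 * r)" using r by simp
  also have "\<dots> = r / 2 * (x 0)\<^sup>2 + \<mu> * x0 * x 0 + \<mu>\<^sup>2 / r / 2 * x0\<^sup>2"
    using r(1) by (simp add: field_simps power2_eq_square)
  also have "\<dots> \<le> r / 2 * (x 0)\<^sup>2 + \<mu> * x0 * x 0 + C / 2 * x0\<^sup>2"
    using C by (intro add_left_mono mult_right_mono divide_right_mono) (auto simp: r_def)
  also have "\<dots> = - 1/2 * (x 0)\<^sup>2 - \<mu> * (x 0 - x0) * x 0 + C / 2 * x0\<^sup>2"
    by (simp add: r_def algebra_simps power2_eq_square add_divide_distrib diff_divide_distrib)
  finally show ?thesis using 1 by (simp add: algebra_simps)
qed

section \<open>The energy estimate in coordinates\<close>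

text \<open>Expand \<open>(2 * m * v - s)\<^sup>2\<close>. The constant keeps the form
  \<open>2 * (2 * m)\<close> because \<open>2 * m\<close> is the \<delta> of the theorem.\<close>

lemma young_min:
  fixes v s a m :: real
  assumes "0 < m" "m \<le> a"
  shows "v * s - a * v\<^sup>2 \<le> 1 / (2 * (2 * m)) * s\<^sup>2"
proof -
  have "0 \<le> (2 * m * v - s)\<^sup>2 / (4 * m)" using assms by simp
  also have "\<dots> = m * v\<^sup>2 - v * s + 1 / (2 * (2 * m)) * s\<^sup>2"
    using assms by (simp add: field_simps power2_eq_square)
  also have "m * v\<^sup>2 \<le> a * v\<^sup>2" using assms by (intro mult_right_mono) auto
  finally show ?thesis by simp
qed


text \<open>Matrix-free form: \<open>w\<close> and \<open>h\<close> contain the grid steps,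
  \<open>a\<close> is the damping and \<open>b\<close> the boundary coefficient. The factor
  \<open>(c i)\<^sup>2 / h i\<close> in front of \<open>b i\<close> disappears once the second
  equation is weighted by \<open>h i / (c i)\<^sup>2\<close>.\<close>

lemma discrete_energy_estimate:
  fixes u v s :: "nat \<Rightarrow> nat \<Rightarrow> real" and D :: "nat \<Rightarrow> nat \<Rightarrow> real"
  assumes Di: "\<And>x. (\<Sum>k<M. w k * (\<Sum>l<M. Di k l * x l) * x k) \<ge> 1/2 * ((x (M - 1))\<^sup>2 - (x 0)\<^sup>2)"
    and Dj: "\<And>x. (\<Sum>k<M. w k * (\<Sum>l<M. Dj k l * x l) * x k) \<ge> 1/2 * ((x (M - 1))\<^sup>2 - (x 0)\<^sup>2)"
    and M: "M > 0" and w: "\<And>k. k < M \<Longrightarrow> w k > 0" and h: "\<And>i. i < N \<Longrightarrow> h i > 0"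
    and c: "\<And>i. i < N \<Longrightarrow> c i \<noteq> 0" and m: "m > 0" "\<And>i. i < N \<Longrightarrow> m \<le> a i"
    and v: "\<And>k i. k < M \<Longrightarrow> i < N \<Longrightarrow> v k i = (\<Sum>l<M. Dj k l * u l i)
              - (if k = 0 then \<mu>1 / w 0 * (u 0 i - f i) else 0)"
    and eq: "\<And>k i. k < M \<Longrightarrow> i < N \<Longrightarrow>
              (\<Sum>l<M. Di k l * v l i) + (a i + (c i)\<^sup>2 / h i * b i) * v k i
              = - (c i)\<^sup>2 / h i * (\<Sum>r<N. D r i * h r * (\<Sum>j<N. D r j * u k j))
                + (if k = 0 then \<mu>3 / w 0 * (v 0 i - g i) else 0) + s k i"
    and \<mu>: "\<mu>1 < - 1/2" "\<mu>3 < - 1/2"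
    and C: "C \<ge> \<mu>1\<^sup>2 / (- 1 - 2 * \<mu>1)" "C \<ge> \<mu>3\<^sup>2 / (- 1 - 2 * \<mu>3)"
  shows "1/2 * ((\<Sum>i<N. h i * (v (M - 1) i / c i)\<^sup>2) + (\<Sum>r<N. h r * (\<Sum>j<N. D r j * u (M - 1) j)\<^sup>2))
           + (\<Sum>k<M. w k * (\<Sum>i<N. b i * (v k i)\<^sup>2))
         \<le> C * (1/2 * ((\<Sum>i<N. h i * (g i / c i)\<^sup>2) + (\<Sum>r<N. h r * (\<Sum>j<N. D r j * f j)\<^sup>2)))
           + 1 / (2 * (2 * m)) * (\<Sum>k<M. w k * (\<Sum>i<N. h i * (s k i / c i)\<^sup>2))"
proof -
  \<comment> \<open>The time derivative of \<open>v\<close> with its penalty moved to the same side,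
    which is the expression that \<open>time_sat_bound\<close> controls.\<close>
  define R where "R k i = (\<Sum>l<M. Di k l * v l i) - (if k = 0 then \<mu>3 / w 0 * (v 0 i - g i) else 0)" for k i
  define du where "du k r = (\<Sum>j<N. D r j * u k j)" for k r
  define dv where "dv k r = (\<Sum>j<N. D r j * v k j)" for k r
  define df where "df r = (\<Sum>j<N. D r j * f j)" for r
  have w0: "w 0 \<noteq> 0" using w M by force
  \<comment> \<open>\<open>D\<close> acts on nodes and \<open>Dj\<close> on time levels, so they
    commute: applying \<open>D\<close> to the first equation gives an equation of the same shape for
    \<open>du\<close>, with the penalty pulling towards \<open>df\<close>.\<close>
  have dv: "dv k r = (\<Sum>l<M. Dj k l * du l r) - (if k = 0 then \<mu>1 / w 0 * (du 0 r - df r) else 0)"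
    if "k < M" for k r
  proof -
    have "dv k r = (\<Sum>j<N. (\<Sum>l<M. Dj k l * (D r j * u l j))
        - (if k = 0 then \<mu>1 / w 0 * (D r j * u 0 j - D r j * f j) else 0))"
      unfolding dv_def using that
      by (intro sum.cong refl) (simp add: v right_diff_distrib sum_distrib_left mult_ac)
    also have "\<dots> = (\<Sum>l<M. Dj k l * du l r) - (if k = 0 then \<mu>1 / w 0 * (du 0 r - df r) else 0)"
      by (subst sum_subtractf, subst sum.swap)
        (auto simp: du_def df_def sum_distrib_left sum_subtractf right_diff_distrib)
    finally show ?thesis .
  qed
  have V: "(\<Sum>k<M. w k * R k i * v k i) \<ge> 1/2 * (v (M - 1) i)\<^sup>2 - C / 2 * (g i)\<^sup>2" for i
    unfolding R_def using time_sat_bound[OF Di M w0 \<mu>(2) C(2), of "\<lambda>k. v k i" "g i"] .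
  have DU: "(\<Sum>k<M. w k * dv k r * du k r) \<ge> 1/2 * (du (M - 1) r)\<^sup>2 - C / 2 * (df r)\<^sup>2" for r
    using time_sat_bound[OF Dj M w0 \<mu>(1) C(1), of "\<lambda>k. du k r" "df r"] by (simp add: dv)
  have "1/2 * (\<Sum>i<N. h i * (v (M - 1) i / c i)\<^sup>2) - C * (1/2 * (\<Sum>i<N. h i * (g i / c i)\<^sup>2))
      = (\<Sum>i<N. h i / (c i)\<^sup>2 * (1/2 * (v (M - 1) i)\<^sup>2 - C / 2 * (g i)\<^sup>2))"
    unfolding sum_distrib_left sum_subtractf[symmetric]
    by (intro sum.cong refl) (simp add: power_divide algebra_simps)
  also have "\<dots> \<le> (\<Sum>i<N. h i / (c i)\<^sup>2 * (\<Sum>k<M. w k * R k i * v k i))"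
    using V h by (intro sum_mono mult_left_mono) (auto intro!: divide_nonneg_nonneg intro: less_imp_le)
  also have "\<dots> = (\<Sum>k<M. w k * (\<Sum>i<N. h i / (c i)\<^sup>2 * R k i * v k i))"
    unfolding sum_distrib_left by (subst sum.swap) (simp add: mult_ac)
  finally have 1: "1/2 * (\<Sum>i<N. h i * (v (M - 1) i / c i)\<^sup>2) - C * (1/2 * (\<Sum>i<N. h i * (g i / c i)\<^sup>2))
      \<le> (\<Sum>k<M. w k * (\<Sum>i<N. h i / (c i)\<^sup>2 * R k i * v k i))" .
  have "1/2 * (\<Sum>r<N. h r * (du (M - 1) r)\<^sup>2) - C * (1/2 * (\<Sum>r<N. h r * (df r)\<^sup>2))
      = (\<Sum>r<N. h r * (1/2 * (du (M - 1) r)\<^sup>2 - C / 2 * (df r)\<^sup>2))"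
    unfolding sum_distrib_left sum_subtractf[symmetric]
    by (intro sum.cong refl) (simp add: algebra_simps)
  also have "\<dots> \<le> (\<Sum>r<N. h r * (\<Sum>k<M. w k * dv k r * du k r))"
    using DU h by (intro sum_mono mult_left_mono) (auto intro: less_imp_le)
  also have "\<dots> = (\<Sum>k<M. w k * (\<Sum>r<N. h r * du k r * dv k r))"
    unfolding sum_distrib_left by (subst sum.swap) (simp add: mult_ac)
  finally have 2: "1/2 * (\<Sum>r<N. h r * (du (M - 1) r)\<^sup>2) - C * (1/2 * (\<Sum>r<N. h r * (df r)\<^sup>2))
      \<le> (\<Sum>k<M. w k * (\<Sum>r<N. h r * du k r * dv k r))" .
  \<comment> \<open>Balance at a single time level, where only the source remains on the
    right.\<close>
  have 3: "(\<Sum>i<N. h i / (c i)\<^sup>2 * R k i * v k i) + (\<Sum>r<N. h r * du k r * dv k r)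
        + (\<Sum>i<N. b i * (v k i)\<^sup>2)
      \<le> 1 / (2 * (2 * m)) * (\<Sum>i<N. h i * (s k i / c i)\<^sup>2)" if k: "k < M" for k
  proof -
    have "(\<Sum>i<N. h i / (c i)\<^sup>2 * R k i * v k i) + (\<Sum>i<N. b i * (v k i)\<^sup>2)
      = (\<Sum>i<N. - (\<Sum>r<N. D r i * h r * du k r) * v k i
          + h i / (c i)\<^sup>2 * (v k i * s k i - a i * (v k i)\<^sup>2))"
      unfolding sum.distrib[symmetric]
    proof (intro sum.cong refl)
      fix i assume "i \<in> {..<N}"
      then have i: "i < N" by simp
      \<comment> \<open>The second equation solved for \<open>R\<close>. Weighting it by
        \<open>h i / (c i)\<^sup>2\<close> leaves \<open>- b i * (v k i)\<^sup>2\<close> from the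
        boundary term, which the added term removes.\<close>
      have R: "R k i = - (c i)\<^sup>2 / h i * (\<Sum>r<N. D r i * h r * du k r) + s k i
          - (a i + (c i)\<^sup>2 / h i * b i) * v k i"
        using eq[OF k i] by (simp add: R_def du_def)
      show "h i / (c i)\<^sup>2 * R k i * v k i + b i * (v k i)\<^sup>2
        = - (\<Sum>r<N. D r i * h r * du k r) * v k i + h i / (c i)\<^sup>2 * (v k i * s k i - a i * (v k i)\<^sup>2)"
        unfolding R using h[OF i] c[OF i] by (simp add: field_simps power2_eq_square)
    qed
    also have "\<dots> = - (\<Sum>i<N. (\<Sum>r<N. D r i * h r * du k r) * v k i)
        + (\<Sum>i<N. h i / (c i)\<^sup>2 * (v k i * s k i - a i * (v k i)\<^sup>2))"
      by (simp add: sum_subtractf)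
    \<comment> \<open>Exchanging the sums moves the transpose of \<open>D\<close> onto
      \<open>v\<close>. With its minus sign this cancels the \<open>du\<close>-\<open>dv\<close>
      term of the claim.\<close>
    also have "(\<Sum>i<N. (\<Sum>r<N. D r i * h r * du k r) * v k i) = (\<Sum>r<N. h r * du k r * dv k r)"
      unfolding dv_def sum_distrib_left sum_distrib_right by (subst sum.swap) (simp add: mult_ac)
    also have "(\<Sum>i<N. h i / (c i)\<^sup>2 * (v k i * s k i - a i * (v k i)\<^sup>2))
        \<le> (\<Sum>i<N. h i / (c i)\<^sup>2 * (1 / (2 * (2 * m)) * (s k i)\<^sup>2))"
      using m h by (intro sum_mono mult_left_mono young_min) (auto intro!: divide_nonneg_nonneg intro: less_imp_le)
    also have "\<dots> = 1 / (2 * (2 * m)) * (\<Sum>i<N. h i * (s k i / c i)\<^sup>2)"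
      unfolding sum_distrib_left by (intro sum.cong refl) (simp add: power_divide)
    finally show ?thesis by simp
  qed
  have "(\<Sum>k<M. w k * (\<Sum>i<N. h i / (c i)\<^sup>2 * R k i * v k i)) + (\<Sum>k<M. w k * (\<Sum>r<N. h r * du k r * dv k r))
        + (\<Sum>k<M. w k * (\<Sum>i<N. b i * (v k i)\<^sup>2))
      = (\<Sum>k<M. w k * ((\<Sum>i<N. h i / (c i)\<^sup>2 * R k i * v k i) + (\<Sum>r<N. h r * du k r * dv k r)
        + (\<Sum>i<N. b i * (v k i)\<^sup>2)))"
    by (simp only: sum.distrib distrib_left)
  also have "\<dots> \<le> (\<Sum>k<M. w k * (1 / (2 * (2 * m)) * (\<Sum>i<N. h i * (s k i / c i)\<^sup>2)))"
    using 3 w by (intro sum_mono mult_left_mono) (auto intro: less_imp_le)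
  also have "\<dots> = 1 / (2 * (2 * m)) * (\<Sum>k<M. w k * (\<Sum>i<N. h i * (s k i / c i)\<^sup>2))"
    unfolding sum_distrib_left by (simp add: mult_ac)
  finally have 4: "(\<Sum>k<M. w k * (\<Sum>i<N. h i / (c i)\<^sup>2 * R k i * v k i))
        + (\<Sum>k<M. w k * (\<Sum>r<N. h r * du k r * dv k r)) + (\<Sum>k<M. w k * (\<Sum>i<N. b i * (v k i)\<^sup>2))
      \<le> 1 / (2 * (2 * m)) * (\<Sum>k<M. w k * (\<Sum>i<N. h i * (s k i / c i)\<^sup>2))" .
  show ?thesis
    using 1 2 4 unfolding du_def df_def distrib_left by linarith
qed

section \<open>The scheme in coordinates and its first order form\<close>

lemma initial_ext_index:
  assumes "f \<in> carrier_vec N" "k < M" "i < N"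
  shows "initial_ext M N f $ (k * N + i) = (if k = 0 then f $ i else 0)"
proof -
  have u: "unit_col M 0 \<in> carrier_mat M 1" by (simp add: unit_col_def mat_of_cols_def)
  have "initial_ext M N f $ (k * N + i) = (\<Sum>l<1::nat. unit_col M 0 $$ (k, l) * f $ (l * N + i))"
    using kron_diag_right[OF u, of f N k i "\<lambda>_. 1"] assms
    by (simp add: initial_ext_def mat_diag_one)
  then show ?thesis using assms by (simp add: unit_col_def mat_of_cols_def)
qed

text \<open>All factors are diagonal, so the boundary conditions only change the damping coefficient
  at the two end nodes.\<close>

lemma boundary_mat_diag:
  assumes "\<And>i. i < N \<Longrightarrow> h i \<noteq> 0" and "0 < N"
  shows "boundary_mat N (mat_diag N h) (mat_diag N c) \<alpha>L \<beta>L \<alpha>R \<beta>R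
    = mat_diag N (\<lambda>i. (c i)\<^sup>2 / h i
        * (\<beta>R / \<alpha>R * (if i = N - 1 then 1 else 0) - \<beta>L / \<alpha>L * (if i = 0 then 1 else 0)))"
  using assms by (simp add: boundary_mat_def inv_mat_diag mat_diag_square mat_diag_diag unit_proj_diag
      mat_diag_smult mat_diag_minus field_simps)

lemma Dxx_tilde_index:
  assumes D: "D \<in> carrier_mat N N" and h: "\<And>i. i < N \<Longrightarrow> h i \<noteq> 0" and i: "i < N" "j < N"
  shows "Dxx_tilde (mat_diag N h) D $$ (i, j) = - 1 / h i * (\<Sum>r<N. D $$ (r, i) * h r * D $$ (r, j))"
proof -
  have "inv_mat (mat_diag N h) * transpose_mat D * mat_diag N h
      = mat N N (\<lambda>(i, r). inverse (h i) * D $$ (r, i) * h r)"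
    using D h by (simp add: inv_mat_diag mat_diag_mult_left[of _ N N] mat_diag_mult_right[of _ N N])
      (intro eq_matI, auto)
  then show ?thesis
    using D i by (simp add: Dxx_tilde_def scalar_prod_def atLeast0LessThan sum_distrib_left sum_negf[symmetric] field_simps)
qed

text \<open>The parameter relations let \<open>V\<close> absorb all of \<open>SAT\<close> except one
  penalty: the \<mu>1 term joins \<open>a i\<close> acting on \<open>V\<close>, the second term
  (\<mu>2 = \<mu>1) goes under \<open>Di\<close>, and the last one (\<mu>4 = - \<mu>1 * \<mu>3)
  turns the discrete derivative of \<open>U\<close> in the \<mu>3 term into
  \<open>V\<close>.\<close>

lemma first_order_form:
  fixes N M :: nat and h c \<sigma> w :: "nat \<Rightarrow> real" and \<alpha>L \<beta>L \<alpha>R \<beta>R \<mu>1 \<mu>3 :: real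
  defines "a \<equiv> \<lambda>i. (\<sigma> i)\<^sup>2 + (c i)\<^sup>2 / h i
        * (\<beta>R / \<alpha>R * (if i = N - 1 then 1 else 0) - \<beta>L / \<alpha>L * (if i = 0 then 1 else 0))"
  assumes scheme: "fully_discrete N M \<mu>1 \<mu>1 \<mu>3 (- \<mu>1 * \<mu>3) (mat_diag M w) Di Dj (mat_diag N h) D
      (mat_diag N c) (mat_diag N \<sigma>) \<alpha>L \<beta>L \<alpha>R \<beta>R f g S U"
    and V: "V = aux_field N M \<mu>1 (mat_diag M w) Dj f U"
    and Di: "Di \<in> carrier_mat M M" and Dj: "Dj \<in> carrier_mat M M" and D: "D \<in> carrier_mat N N"
    and w: "\<And>k. k < M \<Longrightarrow> w k \<noteq> 0" and h: "\<And>i. i < N \<Longrightarrow> h i \<noteq> 0"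
    and f: "f \<in> carrier_vec N" and g: "g \<in> carrier_vec N" and S: "S \<in> carrier_vec (M * N)"
    and k: "k < M" and i: "i < N"
  shows "V $ (k * N + i) = (\<Sum>l<M. Dj $$ (k, l) * U $ (l * N + i))
      - (if k = 0 then \<mu>1 / w 0 * (U $ i - f $ i) else 0)" (is ?V)
    and "(\<Sum>l<M. Di $$ (k, l) * V $ (l * N + i)) + a i * V $ (k * N + i)
      = - (c i)\<^sup>2 / h i * (\<Sum>r<N. D $$ (r, i) * h r * (\<Sum>j<N. D $$ (r, j) * U $ (k * N + j)))
        + (if k = 0 then \<mu>3 / w 0 * (V $ i - g $ i) else 0) + S $ (k * N + i)" (is ?W)
proof -
  \<comment> \<open>Entries of matrix-vector products are to be rewritten by the Kronecker rules,
    not unfolded into scalar products.\<close>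
  note [simp del] = index_mult_mat_vec
  \<comment> \<open>The diagonal of \<open>E\<close>, the inverse of \<open>Ht\<close> times the
    projection to the first time level; it vanishes at all later levels.\<close>
  define e where "e k = (if k = 0 then 1 / w 0 else 0)" for k :: nat
  define E where "E = mat_diag M e"
  define A where "A = mat_diag N a"
  define z where "z k i = (U - initial_ext M N f) $ (k * N + i)" for k i
  define DU where "DU k i = (\<Sum>l<M. Dj $$ (k, l) * U $ (l * N + i))" for k i
  have N: "0 < N" and M: "0 < M" using k i by auto
  have E: "inv_mat (mat_diag M w) * unit_proj M 0 = E"
    using w M by (auto simp: inv_mat_diag unit_proj_diag mat_diag_diag E_def e_def field_simps
        intro!: mat_diag_eqI)
  have A: "mat_diag N \<sigma> ^\<^sub>m 2 + boundary_mat N (mat_diag N h) (mat_diag N c) \<alpha>L \<beta>L \<alpha>R \<beta>R = A"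
    using h N by (simp add: boundary_mat_diag mat_diag_square mat_diag_add A_def a_def)
  have one: "1\<^sub>m n = (mat_diag n (\<lambda>_. 1) :: real mat)" for n by (simp add: mat_diag_one)
  have U: "U \<in> carrier_vec (M * N)" using scheme by (simp add: fully_discrete_def Let_def)
  have Fc: "initial_ext M N x \<in> carrier_vec (M * N)" for x
    by (intro carrier_vecI) (simp add: initial_ext_def unit_col_def mat_of_cols_def)
  have UF: "U - initial_ext M N f \<in> carrier_vec (M * N)" using U Fc by simp
  have DUc: "(Dj \<otimes>\<^sub>K 1\<^sub>m N) *\<^sub>v U - initial_ext M N g \<in> carrier_vec (M * N)"
    by (intro carrier_vecI) (simp add: carrier_vecD[OF Fc])
  \<comment> \<open>The extended initial vector is zero beyond its first block, so \<open>z\<close>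
    is just \<open>U\<close> there; this is harmless because \<open>e k\<close> is 0.\<close>
  have z: "z k i = (if k = 0 then U $ i - f $ i else U $ (k * N + i))" if "k < M" "i < N" for k i
    using that block_index_less[OF that] U Fc[of f] f by (auto simp: z_def initial_ext_index)
  have DUi: "((Dj \<otimes>\<^sub>K 1\<^sub>m N) *\<^sub>v U) $ (k * N + i) = DU k i" if "k < M" "i < N" for k i
    unfolding DU_def by (rule kron_one_right[OF Dj U that])
  have Vi: "V $ (k * N + i) = DU k i - \<mu>1 * (e k * z k i)" if "k < M" "i < N" for k i
    using that block_index_less[OF that] Dj Fc[of f] kron_diag_diag[OF UF that, of e "\<lambda>_. 1"]
    by (simp add: V aux_field_def E E_def DUi z_def)
  show ?V using Vi[OF k i] z[OF k i] by (simp add: e_def DU_def)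
  define r where "r = k * N + i"
  have r: "r < M * N" using block_index_less[OF k i] by (simp add: r_def)
  have "(((Di * Dj) \<otimes>\<^sub>K 1\<^sub>m N) *\<^sub>v U + (Dj \<otimes>\<^sub>K A) *\<^sub>v U
          - (1\<^sub>m M \<otimes>\<^sub>K (mat_diag N c ^\<^sub>m 2 * Dxx_tilde (mat_diag N h) D)) *\<^sub>v U) $ r
      = (SAT N M \<mu>1 \<mu>1 \<mu>3 (- \<mu>1 * \<mu>3) (mat_diag M w) Di Dj A f g U + S) $ r"
    using scheme by (simp add: fully_discrete_def Let_def A)
  moreover have "(((Di * Dj) \<otimes>\<^sub>K 1\<^sub>m N) *\<^sub>v U) $ r = (\<Sum>l<M. Di $$ (k, l) * DU l i)"
  proof -
    have "(((Di * Dj) \<otimes>\<^sub>K 1\<^sub>m N) *\<^sub>v U) $ r = (\<Sum>l<M. (Di * Dj) $$ (k, l) * U $ (l * N + i))"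
      unfolding r_def by (rule kron_one_right[OF mult_carrier_mat[OF Di Dj] U k i])
    also have "\<dots> = (\<Sum>l<M. \<Sum>n<M. Di $$ (k, n) * Dj $$ (n, l) * U $ (l * N + i))"
      using Di Dj k by (intro sum.cong refl) (simp add: scalar_prod_def atLeast0LessThan sum_distrib_right)
    also have "\<dots> = (\<Sum>l<M. Di $$ (k, l) * DU l i)"
      unfolding DU_def sum_distrib_left by (subst sum.swap) (simp add: mult_ac)
    finally show ?thesis .
  qed
  moreover have "((Dj \<otimes>\<^sub>K A) *\<^sub>v U) $ r = a i * DU k i"
    unfolding A_def r_def DU_def by (rule kron_diag_right[OF Dj U k i])
  moreover have "((1\<^sub>m M \<otimes>\<^sub>K (mat_diag N c ^\<^sub>m 2 * Dxx_tilde (mat_diag N h) D)) *\<^sub>v U) $ r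
      = - (c i)\<^sup>2 / h i * (\<Sum>r<N. D $$ (r, i) * h r * (\<Sum>j<N. D $$ (r, j) * U $ (k * N + j)))"
  proof -
    have X: "Dxx_tilde (mat_diag N h) D \<in> carrier_mat N N"
      using D by (intro carrier_matI) (simp_all add: Dxx_tilde_def inv_mat_diag h)
    have "((1\<^sub>m M \<otimes>\<^sub>K (mat_diag N c ^\<^sub>m 2 * Dxx_tilde (mat_diag N h) D)) *\<^sub>v U) $ r
        = (\<Sum>j<N. (c i)\<^sup>2 * Dxx_tilde (mat_diag N h) D $$ (i, j) * U $ (k * N + j))"
      unfolding one r_def mat_diag_square mat_diag_mult_left[OF X]
      using kron_diag_left[OF _ U k i, of "mat N N (\<lambda>(i, j). (c i)\<^sup>2 * Dxx_tilde (mat_diag N h) D $$ (i, j))" "\<lambda>_. 1"] i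
      by simp
    also have "\<dots> = (\<Sum>j<N. \<Sum>r<N. - (c i)\<^sup>2 / h i * (D $$ (r, i) * h r * (D $$ (r, j) * U $ (k * N + j))))"
      using i by (intro sum.cong refl) (simp add: Dxx_tilde_index[OF D h] sum_distrib_left sum_distrib_right mult_ac sum_negf)
    also have "\<dots> = - (c i)\<^sup>2 / h i * (\<Sum>r<N. D $$ (r, i) * h r * (\<Sum>j<N. D $$ (r, j) * U $ (k * N + j)))"
      unfolding sum_distrib_left by (rule sum.swap)
    finally show ?thesis .
  qed
  moreover have "SAT N M \<mu>1 \<mu>1 \<mu>3 (- \<mu>1 * \<mu>3) (mat_diag M w) Di Dj A f g U $ r
      = \<mu>1 * (e k * a i * z k i) + \<mu>1 * (\<Sum>l<M. Di $$ (k, l) * (e l * z l i))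
        + \<mu>3 * (e k * (DU k i - (if k = 0 then g $ i else 0))) + - \<mu>1 * \<mu>3 * (e k * e k * z k i)"
  proof -
    have 1: "((E \<otimes>\<^sub>K A) *\<^sub>v (U - initial_ext M N f)) $ r = e k * a i * z k i"
      unfolding E_def A_def r_def z_def by (rule kron_diag_diag[OF UF k i])
    have "(((Di * E) \<otimes>\<^sub>K 1\<^sub>m N) *\<^sub>v (U - initial_ext M N f)) $ r
        = (\<Sum>l<M. (Di * E) $$ (k, l) * z l i)"
      unfolding r_def z_def using Di by (intro kron_one_right[OF _ UF k i]) (simp add: E_def)
    also have "\<dots> = (\<Sum>l<M. Di $$ (k, l) * (e l * z l i))"
      unfolding E_def mat_diag_mult_right[OF Di] using k by (intro sum.cong refl) simp
    finally have 2: "(((Di * E) \<otimes>\<^sub>K 1\<^sub>m N) *\<^sub>v (U - initial_ext M N f)) $ r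
        = (\<Sum>l<M. Di $$ (k, l) * (e l * z l i))" .
    have 3: "((E \<otimes>\<^sub>K 1\<^sub>m N) *\<^sub>v ((Dj \<otimes>\<^sub>K 1\<^sub>m N) *\<^sub>v U - initial_ext M N g)) $ r
        = e k * (DU k i - (if k = 0 then g $ i else 0))"
      using kron_diag_diag[OF DUc k i, of e "\<lambda>_. 1"] block_index_less[OF k i] DUi[OF k i]
        Fc[of g] initial_ext_index[OF g k i] by (simp add: r_def E_def)
    have 4: "(((E * E) \<otimes>\<^sub>K 1\<^sub>m N) *\<^sub>v (U - initial_ext M N f)) $ r = e k * e k * z k i"
      using kron_diag_diag[OF UF k i, of "\<lambda>k. e k * e k" "\<lambda>_. 1"]
      by (simp add: r_def E_def z_def)
    show ?thesis
      unfolding SAT_def Let_def E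
      using r Di 1 2 3 4 by (simp add: E_def A_def)
  qed
  ultimately have main: "(\<Sum>l<M. Di $$ (k, l) * DU l i) + a i * DU k i
      + (c i)\<^sup>2 / h i * (\<Sum>r<N. D $$ (r, i) * h r * (\<Sum>j<N. D $$ (r, j) * U $ (k * N + j)))
    = \<mu>1 * (e k * a i * z k i) + \<mu>1 * (\<Sum>l<M. Di $$ (k, l) * (e l * z l i))
        + \<mu>3 * (e k * (DU k i - (if k = 0 then g $ i else 0))) - \<mu>1 * \<mu>3 * (e k * e k * z k i) + S $ r"
    using r S Di Dj D by (simp add: A_def)
  have sumV: "(\<Sum>l<M. Di $$ (k, l) * V $ (l * N + i))
      = (\<Sum>l<M. Di $$ (k, l) * DU l i) - \<mu>1 * (\<Sum>l<M. Di $$ (k, l) * (e l * z l i))"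
    unfolding sum_distrib_left sum_subtractf[symmetric]
    using i by (intro sum.cong refl) (simp add: Vi right_diff_distrib mult.left_commute)
  have Vr: "V $ r = DU k i - \<mu>1 * (e k * z k i)" using Vi[OF k i] by (simp add: r_def)
  \<comment> \<open>For \<open>k = 0\<close> the index \<open>r\<close> equals \<open>i\<close>; for
    other \<open>k\<close> both sides are 0.\<close>
  have sat: "(if k = 0 then \<mu>3 / w 0 * (V $ i - g $ i) else 0)
      = \<mu>3 * (e k * (V $ r - (if k = 0 then g $ i else 0)))"
    by (simp add: e_def r_def)
  \<comment> \<open>The sums become opaque reals: here \<open>A\<close> and \<open>B\<close> are
    numbers, the \<open>Di\<close> sums over \<open>DU\<close> and over \<open>e l * z l i\<close>.
    What remains is a polynomial identity, in which the \<mu>3 term with \<open>V'\<close> inserted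
    produces \<open>e' * e' * z'\<close>.\<close>
  have alg: "A - \<mu>1 * B + a' * V' = - c' / h' * X + \<mu>3 * (e' * (V' - g')) + S'"
    if "A + a' * U' + c' / h' * X
        = \<mu>1 * (e' * a' * z') + \<mu>1 * B + \<mu>3 * (e' * (U' - g')) - \<mu>1 * \<mu>3 * (e' * e' * z') + S'"
      and "V' = U' - \<mu>1 * (e' * z')" for A B a' V' c' h' X e' g' S' U' z' :: real
    using that(1) unfolding that(2) by (simp add: algebra_simps)
  show ?W unfolding r_def[symmetric] sumV sat by (rule alg[OF main Vr])
qed


section \<open>Norms, energy and boundary term as sums over nodes\<close>

lemma norm_sq_scaled:
  assumes "v \<in> carrier_vec N" "\<And>i. i < N \<Longrightarrow> c i \<noteq> 0"
  shows "norm_sq (mat_diag N h) (inv_mat (mat_diag N c) *\<^sub>v v) = (\<Sum>i<N. h i * (v $ i / c i)\<^sup>2)"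
  using assms by (simp add: norm_sq_def inv_mat_diag mat_diag_mult_vec inner_prod_diag
      power2_eq_square field_simps)

lemma energy_diag:
  assumes "D \<in> carrier_mat N N" "u \<in> carrier_vec N" "v \<in> carrier_vec N" "\<And>i. i < N \<Longrightarrow> c i \<noteq> 0"
  shows "energy (mat_diag N h) D (mat_diag N c) u v
    = 1/2 * ((\<Sum>i<N. h i * (v $ i / c i)\<^sup>2) + (\<Sum>r<N. h r * (\<Sum>j<N. D $$ (r, j) * u $ j)\<^sup>2))"
proof -
  have "norm_sq (mat_diag N h) (D *\<^sub>v u) = (\<Sum>r<N. h r * (\<Sum>j<N. D $$ (r, j) * u $ j)\<^sup>2)"
    using assms(1,2) unfolding norm_sq_def
    by (subst inner_prod_diag)
      (auto simp: mult_mat_vec_index power2_eq_square mult_ac simp del: index_mult_mat_vec intro!: sum.cong)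
  then show ?thesis using assms by (simp add: energy_def norm_sq_scaled)
qed

text \<open>The coefficients are those that \<open>boundary_mat_diag\<close> leaves after removing
  \<open>(c i)\<^sup>2 / h i\<close>, so they can serve as \<open>b\<close> in the coordinate
  estimate.\<close>

lemma boundary_term_sum:
  assumes "0 < N"
  shows "boundary_term N \<alpha>L \<beta>L \<alpha>R \<beta>R v
    = (\<Sum>i<N. (\<beta>R / \<alpha>R * (if i = N - 1 then 1 else 0) - \<beta>L / \<alpha>L * (if i = 0 then 1 else 0)) * (v $ i)\<^sup>2)"
proof -
  have "(\<Sum>i<N. (\<beta>R / \<alpha>R * (if i = N - 1 then 1 else 0) - \<beta>L / \<alpha>L * (if i = 0 then 1 else 0)) * (v $ i)\<^sup>2)
    = (\<Sum>i<N. (if i = N - 1 then \<beta>R / \<alpha>R * (v $ i)\<^sup>2 else 0) - (if i = 0 then \<beta>L / \<alpha>L * (v $ i)\<^sup>2 else 0))"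
    by (intro sum.cong refl) (auto simp: algebra_simps)
  then show ?thesis using assms by (simp add: sum_subtractf boundary_term_def)
qed

text \<open>Each quotient takes its sign from the corresponding product.\<close>

lemma boundary_term_nonneg:
  assumes "\<alpha>L * \<beta>L \<le> 0" "\<alpha>R * \<beta>R \<ge> 0"
  shows "boundary_term N \<alpha>L \<beta>L \<alpha>R \<beta>R v \<ge> 0"
proof -
  have "\<beta>R / \<alpha>R \<ge> 0" "\<beta>L / \<alpha>L \<le> 0"
    using assms by (auto simp: zero_le_mult_iff mult_le_0_iff zero_le_divide_iff divide_le_0_iff)
  then have "\<beta>R / \<alpha>R * (v $ (N - 1))\<^sup>2 \<ge> 0" "\<beta>L / \<alpha>L * (v $ 0)\<^sup>2 \<le> 0"
    by (auto intro: mult_nonneg_nonneg mult_nonpos_nonneg simp del: times_divide_eq_left)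
  then show ?thesis by (simp add: boundary_term_def)
qed

section \<open>The estimate on the grids\<close>

text \<open>Used to transfer \<open>c x \<noteq> 0\<close>, assumed on the interval, to the
  nodes.\<close>

lemma grid_pt_in:
  assumes "a < b" "2 \<le> n" "i < n"
  shows "grid_pt a b n i \<in> {a..b}"
proof -
  have "real i / (real n - 1) \<le> 1" "0 \<le> real i / (real n - 1)" using assms by (auto simp: field_simps)
  then have "0 \<le> real i / (real n - 1) * (b - a)" "real i / (real n - 1) * (b - a) \<le> 1 * (b - a)"
    using assms(1) by (intro mult_nonneg_nonneg mult_right_mono; simp)+
  then show ?thesis by (simp add: grid_pt_def grid_step_def field_simps)
qed

text \<open>The grid steps stay hidden in \<open>w\<close> and \<open>h\<close>, and the lower
  bounds on \<open>C\<close> involve only the penalty parameters.\<close>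

lemma fully_discrete_energy_estimate:
  fixes N M :: nat and h c \<sigma> w :: "nat \<Rightarrow> real" and \<alpha>L \<beta>L \<alpha>R \<beta>R \<mu>1 \<mu>3 :: real
  assumes scheme: "fully_discrete N M \<mu>1 \<mu>1 \<mu>3 (- \<mu>1 * \<mu>3) (mat_diag M w) Di Dj (mat_diag N h) D
      (mat_diag N c) (mat_diag N \<sigma>) \<alpha>L \<beta>L \<alpha>R \<beta>R f g S U"
    and V: "V = aux_field N M \<mu>1 (mat_diag M w) Dj f U"
    and Di: "Di \<in> carrier_mat M M" and Dj: "Dj \<in> carrier_mat M M" and D: "D \<in> carrier_mat N N"
    and Bi: "\<And>x. (\<Sum>k<M. w k * (\<Sum>l<M. Di $$ (k, l) * x l) * x k) \<ge> 1/2 * ((x (M - 1))\<^sup>2 - (x 0)\<^sup>2)"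
    and Bj: "\<And>x. (\<Sum>k<M. w k * (\<Sum>l<M. Dj $$ (k, l) * x l) * x k) \<ge> 1/2 * ((x (M - 1))\<^sup>2 - (x 0)\<^sup>2)"
    and w: "\<And>k. k < M \<Longrightarrow> w k > 0" and h: "\<And>i. i < N \<Longrightarrow> h i > 0"
    and c: "\<And>i. i < N \<Longrightarrow> c i \<noteq> 0" and m: "m > 0" "\<And>i. i < N \<Longrightarrow> m \<le> (\<sigma> i)\<^sup>2"
    and f: "f \<in> carrier_vec N" and g: "g \<in> carrier_vec N" and S: "S \<in> carrier_vec (M * N)"
    and M: "0 < M" and N: "0 < N"
    and \<mu>: "\<mu>1 < - 1/2" "\<mu>3 < - 1/2"
    and C: "C \<ge> \<mu>1\<^sup>2 / (- 1 - 2 * \<mu>1)" "C \<ge> \<mu>3\<^sup>2 / (- 1 - 2 * \<mu>3)"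
  shows "energy (mat_diag N h) D (mat_diag N c) (block N U (M - 1)) (block N V (M - 1))
           + (\<Sum>k<M. w k * boundary_term N \<alpha>L \<beta>L \<alpha>R \<beta>R (block N V k))
         \<le> C * energy (mat_diag N h) D (mat_diag N c) f g
           + 1 / (2 * (2 * m)) * (\<Sum>k<M. w k * norm_sq (mat_diag N h) (inv_mat (mat_diag N c) *\<^sub>v block N S k))"
proof -
  have wh: "\<And>k. k < M \<Longrightarrow> w k \<noteq> 0" "\<And>i. i < N \<Longrightarrow> h i \<noteq> 0" using w h by force+
  note form = first_order_form[OF scheme V Di Dj D wh f g S]
  have bl: "block N X k \<in> carrier_vec N" for X k by (simp add: block_def)
  have "1/2 * ((\<Sum>i<N. h i * (V $ ((M - 1) * N + i) / c i)\<^sup>2)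
          + (\<Sum>r<N. h r * (\<Sum>j<N. D $$ (r, j) * U $ ((M - 1) * N + j))\<^sup>2))
           + (\<Sum>k<M. w k * (\<Sum>i<N. (\<beta>R / \<alpha>R * (if i = N - 1 then 1 else 0)
               - \<beta>L / \<alpha>L * (if i = 0 then 1 else 0)) * (V $ (k * N + i))\<^sup>2))
         \<le> C * (1/2 * ((\<Sum>i<N. h i * (g $ i / c i)\<^sup>2) + (\<Sum>r<N. h r * (\<Sum>j<N. D $$ (r, j) * f $ j)\<^sup>2)))
           + 1 / (2 * (2 * m)) * (\<Sum>k<M. w k * (\<Sum>i<N. h i * (S $ (k * N + i) / c i)\<^sup>2))"
    \<comment> \<open>Unification finds \<open>b\<close> from the goal. Block 0 has the indices
      \<open>0 * N + i\<close>, which must be reduced to \<open>i\<close> before \<open>form\<close>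
      fits.\<close>
    by (rule discrete_energy_estimate[where u = "\<lambda>k i. U $ (k * N + i)" and v = "\<lambda>k i. V $ (k * N + i)"
          and Di = "\<lambda>k l. Di $$ (k, l)" and Dj = "\<lambda>k l. Dj $$ (k, l)" and D = "\<lambda>k l. D $$ (k, l)"
          and f = "\<lambda>i. f $ i" and g = "\<lambda>i. g $ i" and s = "\<lambda>k i. S $ (k * N + i)"
          and a = "\<lambda>i. (\<sigma> i)\<^sup>2" and ?\<mu>1.0 = \<mu>1 and ?\<mu>3.0 = \<mu>3,
          OF Bi Bj M w h c m _ _ \<mu> C])
      (simp_all only: mult_0 add_0_left, rule form(1), assumption+, rule form(2), assumption+)
  moreover have "block N X k $ i = X $ (k * N + i)" if "i < N" for X k i
    using that by (simp add: block_def)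
  ultimately show ?thesis
    using N by (simp add: energy_diag[OF D _ _ c] norm_sq_scaled[OF _ c] bl f g boundary_term_sum)
qed

section \<open>One constant for all grids and data\<close>

theorem theorem10:
  fixes \<mu>1 \<mu>2 \<mu>3 \<mu>4 :: real
  assumes "\<mu>1 < - 1/2" and "\<mu>3 < - 1/2" and "\<mu>2 = \<mu>1" and "\<mu>4 = - \<mu>1 * \<mu>3"
  shows "\<exists>C>0. \<forall>(xL::real) (xR::real) (T::real) (c::real \<Rightarrow> real) (\<sigma>::real \<Rightarrow> real) (src::real \<Rightarrow> real \<Rightarrow> real)
      (\<alpha>L::real) (\<beta>L::real) (\<alpha>R::real) (\<beta>R::real)
      (p::nat) (N0::nat) (hx::nat \<Rightarrow> nat \<Rightarrow> real) (Dm::nat \<Rightarrow> real mat) (Dp::nat \<Rightarrow> real mat)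
      (q::nat) (M0::nat) (ht::nat \<Rightarrow> nat \<Rightarrow> real) (Dt::nat \<Rightarrow> nat \<Rightarrow> real mat).
    xL < xR \<longrightarrow> 0 < T \<longrightarrow> (\<forall>x\<in>{xL..xR}. c x \<noteq> 0) \<longrightarrow>
    \<alpha>L \<noteq> 0 \<longrightarrow> \<alpha>R \<noteq> 0 \<longrightarrow> \<alpha>L * \<beta>L \<le> 0 \<longrightarrow> \<alpha>R * \<beta>R \<ge> 0 \<longrightarrow>
    dp_sbp xL xR p N0 hx Dm Dp \<longrightarrow>
    (\<forall>l\<in>{1,2}. time_sbp T q M0 ht (Dt l)) \<longrightarrow>
    (\<forall>N\<ge>N0. \<forall>M\<ge>M0. \<forall>i\<in>{1,2}. \<forall>j\<in>{1,2}.
     \<forall>f\<in>carrier_vec N. \<forall>g\<in>carrier_vec N. \<forall>U V.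
      let Hx = norm_mat xL xR N (hx N); Ht = norm_mat 0 T M (ht M); \<Delta>t = grid_step 0 T M;
          cm = grid_diag xL xR N c; \<sigma>m = grid_diag xL xR N \<sigma>;
          \<delta> = 2 * Min ((\<lambda>n. (\<sigma> (grid_pt xL xR N n))\<^sup>2) ` {..<N});
          S = source_vec xL xR T N M src;
          BT = (\<lambda>k. boundary_term N \<alpha>L \<beta>L \<alpha>R \<beta>R (block N V k))
      in
      (\<forall>n<N. \<sigma> (grid_pt xL xR N n) \<noteq> 0) \<longrightarrow>
      fully_discrete N M \<mu>1 \<mu>2 \<mu>3 \<mu>4 Ht (Dt i M) (Dt j M) Hx (Dm N) cm \<sigma>m \<alpha>L \<beta>L \<alpha>R \<beta>R
        f g (source_ext xL xR T N M src) U \<longrightarrow>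
      V = aux_field N M \<mu>1 Ht (Dt j M) f U \<longrightarrow>
      energy Hx (Dm N) cm (block N U (M - 1)) (block N V (M - 1)) + (\<Sum>k<M. BT k * ht M k * \<Delta>t)
        \<le> C * energy Hx (Dm N) cm f g
          + 1 / (2 * \<delta>) * (\<Sum>k<M. ht M k * norm_sq Hx (inv_mat cm *\<^sub>v S k) * \<Delta>t)
      \<and> (\<forall>k<M. BT k \<ge> 0))"
proof -
  \<comment> \<open>The sum of the two penalty factors, from \<open>v\<close> and from
    \<open>du\<close>, dominates each because both are positive. It depends on \<mu>1 and \<mu>3
    alone.\<close>
  define C where "C = \<mu>1\<^sup>2 / (- 1 - 2 * \<mu>1) + \<mu>3\<^sup>2 / (- 1 - 2 * \<mu>3)"
  have "\<mu>1\<^sup>2 / (- 1 - 2 * \<mu>1) > 0" "\<mu>3\<^sup>2 / (- 1 - 2 * \<mu>3) > 0"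
    using assms(1,2) by (auto intro!: divide_pos_pos)
  then have C: "C > 0" "C \<ge> \<mu>1\<^sup>2 / (- 1 - 2 * \<mu>1)" "C \<ge> \<mu>3\<^sup>2 / (- 1 - 2 * \<mu>3)"
    by (simp_all add: C_def)
  show ?thesis
    unfolding Let_def assms(3,4)
  proof (rule exI[of _ C], intro conjI allI impI ballI C(1))
    fix xL xR T :: real and c \<sigma> :: "real \<Rightarrow> real" and src :: "real \<Rightarrow> real \<Rightarrow> real"
      and \<alpha>L \<beta>L \<alpha>R \<beta>R :: real and p N0 :: nat and hx :: "nat \<Rightarrow> nat \<Rightarrow> real" and Dm Dp :: "nat \<Rightarrow> real mat"
      and q M0 :: nat and ht :: "nat \<Rightarrow> nat \<Rightarrow> real" and Dt :: "nat \<Rightarrow> nat \<Rightarrow> real mat"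
      and N M i j :: nat and f g U V :: "real vec" and k :: nat
    assume x: "xL < xR" and T: "0 < T" and c: "\<forall>x\<in>{xL..xR}. c x \<noteq> 0"
      and ab: "\<alpha>L \<noteq> 0" "\<alpha>R \<noteq> 0" "\<alpha>L * \<beta>L \<le> 0" "\<alpha>R * \<beta>R \<ge> 0"
      and sbp: "dp_sbp xL xR p N0 hx Dm Dp" and tsbp: "\<forall>l\<in>{1,2}. time_sbp T q M0 ht (Dt l)"
      and NM: "N0 \<le> N" "M0 \<le> M" and ij: "i \<in> {1,2}" "j \<in> {1,2}"
      and f: "f \<in> carrier_vec N" and g: "g \<in> carrier_vec N"
      and \<sigma>: "\<forall>n<N. \<sigma> (grid_pt xL xR N n) \<noteq> 0"
      and scheme: "fully_discrete N M \<mu>1 \<mu>1 \<mu>3 (- \<mu>1 * \<mu>3) (norm_mat 0 T M (ht M)) (Dt i M) (Dt j M)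
        (norm_mat xL xR N (hx N)) (Dm N) (grid_diag xL xR N c) (grid_diag xL xR N \<sigma>) \<alpha>L \<beta>L \<alpha>R \<beta>R
        f g (source_ext xL xR T N M src) U"
      and V: "V = aux_field N M \<mu>1 (norm_mat 0 T M (ht M)) (Dt j M) f U"
    show "boundary_term N \<alpha>L \<beta>L \<alpha>R \<beta>R (block N V k) \<ge> 0"
      by (rule boundary_term_nonneg[OF ab(3,4)])
    have tl: "time_sbp T q M0 ht (Dt l)" if "l \<in> {1,2}" for l using tsbp that by blast
    have "2 \<le> N0" "2 \<le> M0"
      using sbp tl[OF ij(1)] unfolding dp_sbp_def time_sbp_def by blast+
    then have N: "2 \<le> N" and M: "2 \<le> M" using NM by simp_all
    let ?w = "\<lambda>k. ht M k * grid_step 0 T M" and ?h = "\<lambda>i. hx N i * grid_step xL xR N"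
    let ?c = "\<lambda>i. c (grid_pt xL xR N i)" and ?\<sigma> = "\<lambda>i. \<sigma> (grid_pt xL xR N i)"
    \<comment> \<open>Half of \<delta>. As \<open>N\<close> is at least 2, the minimum runs over a
      nonempty finite set, is attained, and is therefore positive.\<close>
    define m where "m = Min ((\<lambda>n. (?\<sigma> n)\<^sup>2) ` {..<N})"
    have m: "m > 0" "\<And>n. n < N \<Longrightarrow> m \<le> (?\<sigma> n)\<^sup>2"
      using \<sigma> N by (auto simp: m_def Min_gr_iff lessThan_empty_iff)
    have "pos_def M (mat_diag M ?w)" "pos_def N (mat_diag N ?h)"
      using sbp tl[OF ij(1)] NM unfolding dp_sbp_def time_sbp_def quadrature_norm_def norm_mat_def by blast+
    note w = pos_def_diag[OF this(1)] and h = pos_def_diag[OF this(2)]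
    have cn: "?c n \<noteq> 0" if "n < N" for n
      using c grid_pt_in[OF x N that] by blast
    have D: "Dm N \<in> carrier_mat N N"
      using sbp NM(1) unfolding dp_sbp_def exact_deriv_def Let_def by blast
    have Dt: "Dt l M \<in> carrier_mat M M" if "l \<in> {1,2}" for l
      using tl[OF that] NM(2) unfolding time_sbp_def exact_deriv_def by blast
    have B: "(\<Sum>k<M. ?w k * (\<Sum>n<M. Dt l M $$ (k, n) * x n) * x k) \<ge> 1/2 * ((x (M - 1))\<^sup>2 - (x 0)\<^sup>2)"
      if "l \<in> {1,2}" for l x
      using tl[OF that] NM(2) unfolding time_sbp_def norm_mat_def
      by (intro time_sbp_scalar[OF Dt[OF that] M]) blast
    have S: "source_ext xL xR T N M src \<in> carrier_vec (M * N)" by (simp add: source_ext_def)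
    \<comment> \<open>The bound on \<open>k\<close> keeps the index below \<open>M * N\<close>,
      where the stacked source is specified; \<open>div\<close> and \<open>mod\<close> then recover
      block and node.\<close>
    have blS: "block N (source_ext xL xR T N M src) k = source_vec xL xR T N M src k" if "k < M" for k
    proof (rule eq_vecI)
      fix n assume "n < dim_vec (source_vec xL xR T N M src k)"
      then have n: "n < N" by (simp add: source_vec_def grid_fun_def)
      from that n have "k * N + n < M * N" by (rule block_index_less)
      then show "block N (source_ext xL xR T N M src) k $ n = source_vec xL xR T N M src k $ n"
        using n by (simp add: block_def source_ext_def)
    qed (simp add: block_def source_vec_def grid_fun_def)
    have "energy (mat_diag N ?h) (Dm N) (mat_diag N ?c) (block N U (M - 1)) (block N V (M - 1))
           + (\<Sum>k<M. ?w k * boundary_term N \<alpha>L \<beta>L \<alpha>R \<beta>R (block N V k))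
         \<le> C * energy (mat_diag N ?h) (Dm N) (mat_diag N ?c) f g
           + 1 / (2 * (2 * m)) * (\<Sum>k<M. ?w k * norm_sq (mat_diag N ?h)
               (inv_mat (mat_diag N ?c) *\<^sub>v block N (source_ext xL xR T N M src) k))"
      using M N by (intro fully_discrete_energy_estimate[OF
            scheme[unfolded norm_mat_def grid_diag_def] V[unfolded norm_mat_def]
            Dt[OF ij(1)] Dt[OF ij(2)] D B[OF ij(1)] B[OF ij(2)] w h cn m f g S _ _ assms(1,2) C(2,3)]) auto
    then show "energy (norm_mat xL xR N (hx N)) (Dm N) (grid_diag xL xR N c) (block N U (M - 1)) (block N V (M - 1))
        + (\<Sum>k<M. boundary_term N \<alpha>L \<beta>L \<alpha>R \<beta>R (block N V k) * ht M k * grid_step 0 T M)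
      \<le> C * energy (norm_mat xL xR N (hx N)) (Dm N) (grid_diag xL xR N c) f g
        + 1 / (2 * (2 * Min ((\<lambda>n. (\<sigma> (grid_pt xL xR N n))\<^sup>2) ` {..<N})))
          * (\<Sum>k<M. ht M k * norm_sq (norm_mat xL xR N (hx N))
              (inv_mat (grid_diag xL xR N c) *\<^sub>v source_vec xL xR T N M src k) * grid_step 0 T M)"
      by (simp add: blS norm_mat_def grid_diag_def m_def mult_ac)
  qed
qed

end
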